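(* Let $A$ be a graph of order $n$ and let $A_1,A_2,\dots$ be the sequence of the SaS process applied to $A$. Then: (1) each $A_i$ recognizes vertices; (2) $A_i\rightarrowtail A_{i+1}$ and $\dim(A_i)\le\dim(A_{i+1})$ for every integer $i>0$; (3) if $\dim(A_t)=\dim(A_{t+1})$ for some $t\in\mathbb{Z}^+$, then $A_t\approx\hat A$.
   Context: Labels are independent commuting indeterminates $x_0,x_1,\dots$; $\mathrm{Var}=\{x_1,x_2,\dots\}$. A graph of order $n$ is a symmetric $n\times n$ matrix over $\{x_0\}\cup\mathrm{Var}$; $\dim(G)$ is its number of distinct entries. Products and powers ($G^0=I$) are computed in the commutative polynomial ring over $\mathbb{R}$ in the indeterminates and an extra indeterminate $\lambda$. $A\rightarrowtail B$ means $b_{ij}=b_{st}\Rightarrow a_{ij}=a_{st}$ for all $i,j,s,t$; $A\approx B$ means both directions. An equivalent variable substitution replaces the entries of a matrix by variables of $\mathrm{Var}$, equal entries by equal variables and distinct by distinct. A graph recognizes vertices if no diagonal entry equals an off-diagonal entry. Description graph: $\tilde G$ is obtained from $\Gamma(G)=\sum_{k=0}^{n-1}\lambda^kG^k$ by an equivalent variable substitution. Stable graph $\hat A$: set $B_0=A$, $B_{k+1}=\tilde{B_k}$, and $\hat A:=B_t$ for the first $t$ with $\dim(B_t)=\dim(B_{t+1})$ (defined up to $\approx$). SaS process: $A_1$ is $A$ with its diagonal entries replaced by an equivalent variable substitution using fresh variables not occurring off the diagonal (off-diagonal entries unchanged); $A_{i+1}$ is obtained from $A_i^2$ by an equivalent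 variable substitution. *)

theory Defs
  imports "Jordan_Normal_Form.Matrix" "HOL-Library.Poly_Mapping"
    "HOL-Computational_Algebra.Polynomial"
begin

text \<open>
  The ring of real polynomials in the commuting indeterminates \<open>xvar 0, xvar 1, \<dots>\<close>: finitely supported
  maps from monomials (finitely supported exponent vectors) to coefficients, with the convolution
  product of \<^theory>\<open>HOL-Library.Poly_Mapping\<close>. The ring with the extra indeterminate \<open>\<lambda>\<close> is
  \<open>xpoly poly\<close>, that is, polynomials in \<open>\<lambda>\<close> over this ring.
\<close>

type_synonym xpoly = "(nat \<Rightarrow>\<^sub>0 nat) \<Rightarrow>\<^sub>0 real"

definition xvar :: "nat \<Rightarrow> xpoly" where
  "xvar i = Poly_Mapping.single (Poly_Mapping.single i 1) 1"

definition Var :: "xpoly set" where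
  "Var = {xvar i | i. i \<ge> 1}"

definition is_graph :: "nat \<Rightarrow> xpoly mat \<Rightarrow> bool" where
  "is_graph n G \<longleftrightarrow> G \<in> carrier_mat n n \<and> transpose_mat G = G
     \<and> elements_mat G \<subseteq> {xvar 0} \<union> Var"

definition gdim :: "'a mat \<Rightarrow> nat" where
  "gdim G = card (elements_mat G)"

text \<open>
  Note the direction of the arrow: equality of entries of \<open>B\<close> forces equality of entries of \<open>A\<close>.
  The two matrices are always required to have the same size.
\<close>

definition coarser :: "'a mat \<Rightarrow> 'b mat \<Rightarrow> bool" (infix "\<rightarrowtail>" 50) where
  "A \<rightarrowtail> B \<longleftrightarrow> dim_row A = dim_row B \<and> dim_col A = dim_col B
     \<and> (\<forall>i < dim_row B. \<forall>j < dim_col B. \<forall>s < dim_row B. \<forall>t < dim_col B.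
          B $$ (i, j) = B $$ (s, t) \<longrightarrow> A $$ (i, j) = A $$ (s, t))"

definition equivalent_mats :: "'a mat \<Rightarrow> 'b mat \<Rightarrow> bool" (infix "\<approx>\<^sub>g" 50) where
  "A \<approx>\<^sub>g B \<longleftrightarrow> A \<rightarrowtail> B \<and> B \<rightarrowtail> A"

text \<open>
  \<open>equiv_var_subst M N\<close>: the matrix \<open>N\<close> is a possible result of an equivalent variable substitution
  in \<open>M\<close>. The choice of variables is not canonical, hence a relation.
\<close>

definition equiv_var_subst :: "'a mat \<Rightarrow> xpoly mat \<Rightarrow> bool" where
  "equiv_var_subst M N \<longleftrightarrow> dim_row N = dim_row M \<and> dim_col N = dim_col M
     \<and> elements_mat N \<subseteq> Var
     \<and> (\<forall>i < dim_row M. \<forall>j < dim_col M. \<forall>s < dim_row M. \<forall>t < dim_col M.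
          N $$ (i, j) = N $$ (s, t) \<longleftrightarrow> M $$ (i, j) = M $$ (s, t))"

definition recognizes_vertices :: "'a mat \<Rightarrow> bool" where
  "recognizes_vertices G \<longleftrightarrow>
     (\<forall>i < dim_row G. \<forall>s < dim_row G. \<forall>t < dim_row G. s \<noteq> t \<longrightarrow> G $$ (i, i) \<noteq> G $$ (s, t))"

definition Gam :: "xpoly mat \<Rightarrow> xpoly poly mat" where
  "Gam G = mat (dim_row G) (dim_row G)
     (\<lambda>(i, j). \<Sum>k < dim_row G. [:0, 1:] ^ k * [: (G ^\<^sub>m k) $$ (i, j) :])"

definition description_graph :: "xpoly mat \<Rightarrow> xpoly mat \<Rightarrow> bool" where
  "description_graph G D \<longleftrightarrow> equiv_var_subst (Gam G) D"

definition stable_graph :: "xpoly mat \<Rightarrow> xpoly mat \<Rightarrow> bool" where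
  "stable_graph A S \<longleftrightarrow> (\<exists>B t. B 0 = A \<and> (\<forall>k. description_graph (B k) (B (Suc k)))
     \<and> gdim (B t) = gdim (B (Suc t)) \<and> (\<forall>s < t. gdim (B s) \<noteq> gdim (B (Suc s))) \<and> S = B t)"

definition diagonal_subst :: "xpoly mat \<Rightarrow> xpoly mat \<Rightarrow> bool" where
  "diagonal_subst A A' \<longleftrightarrow> dim_row A' = dim_row A \<and> dim_col A' = dim_col A
     \<and> (\<forall>i < dim_row A. \<forall>j < dim_row A. i \<noteq> j \<longrightarrow> A' $$ (i, j) = A $$ (i, j))
     \<and> (\<forall>i < dim_row A. A' $$ (i, i) \<in> Var)
     \<and> (\<forall>i < dim_row A. \<forall>j < dim_row A. A' $$ (i, i) = A' $$ (j, j) \<longleftrightarrow> A $$ (i, i) = A $$ (j, j))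
     \<and> (\<forall>i < dim_row A. \<forall>s < dim_row A. \<forall>t < dim_row A. s \<noteq> t \<longrightarrow> A' $$ (i, i) \<noteq> A $$ (s, t))"

text \<open>The terms of the sequence are numbered from 1; \<open>As 0\<close> is unconstrained.\<close>

definition SaS :: "xpoly mat \<Rightarrow> (nat \<Rightarrow> xpoly mat) \<Rightarrow> bool" where
  "SaS A As \<longleftrightarrow> diagonal_subst A (As 1) \<and> (\<forall>i \<ge> 1. equiv_var_subst (As i ^\<^sub>m 2) (As (i + 1)))"


text \<open>
  Since the constructions are relations, we check that every matrix has an equivalent variable
  substitution and that every graph has a SaS sequence and a stable graph.
\<close>

lemma inj_xvar: "inj xvar"
proof (rule injI)
  fix i j assume "xvar i = xvar j"
  then have "Poly_Mapping.keys (xvar i) = Poly_Mapping.keys (xvar j)" by simp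
  then have "Poly_Mapping.single i (1::nat) = Poly_Mapping.single j 1" by (simp add: xvar_def)
  then have "Poly_Mapping.keys (Poly_Mapping.single i (1::nat)) = Poly_Mapping.keys (Poly_Mapping.single j (1::nat))"
    by simp
  then show "i = j" by simp
qed

lemma infinite_Var: "infinite Var"
proof -
  have "Var = xvar ` {1..}" by (auto simp: Var_def)
  then show ?thesis
    using finite_imageD[of xvar "{1..}"] inj_xvar infinite_Ici[of "1::nat"]
    by (metis inj_on_subset subset_UNIV)
qed

lemma finite_elements_mat: "finite (elements_mat A)"
  by (simp add: elements_mat_def)

lemma elements_mat_iff:
  "a \<in> elements_mat A \<longleftrightarrow> (\<exists>i j. i < dim_row A \<and> j < dim_col A \<and> a = A $$ (i, j))"
proof
  assume "a \<in> elements_mat A"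
  then show "\<exists>i j. i < dim_row A \<and> j < dim_col A \<and> a = A $$ (i, j)" by blast
next
  assume "\<exists>i j. i < dim_row A \<and> j < dim_col A \<and> a = A $$ (i, j)"
  then show "a \<in> elements_mat A" using elements_matI[of A "dim_row A" "dim_col A"] by blast
qed

lemma ex_inj_into_infinite:
  assumes "finite A" "infinite B"
  shows "\<exists>f. inj_on f A \<and> f ` A \<subseteq> B"
proof -
  obtain C where "finite C" "card C = card A" "C \<subseteq> B"
    using infinite_arbitrarily_large[OF assms(2)] by blast
  moreover then obtain f where "bij_betw f A C"
    using finite_same_card_bij[OF assms(1)] by metis
  ultimately show ?thesis by (auto simp: bij_betw_def)
qed

lemma ex_equiv_var_subst: "\<exists>N. equiv_var_subst M N"
proof -
  obtain f where f: "inj_on f (elements_mat M)" "f ` elements_mat M \<subseteq> Var"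
    using ex_inj_into_infinite[OF finite_elements_mat[of M] infinite_Var] by (elim exE conjE)
  have el: "M $$ (i, j) \<in> elements_mat M" if "i < dim_row M" "j < dim_col M" for i j
    using that unfolding elements_mat_iff by blast
  have "equiv_var_subst M (map_mat f M)"
    unfolding equiv_var_subst_def using f(2) by (simp add: inj_on_eq_iff[OF f(1)] el)
  then show ?thesis by (rule exI)
qed

lemma ex_SaS:
  assumes A: "is_graph n A"
  shows "\<exists>As. SaS A As"
proof -
  have [simp]: "dim_row A = n" "dim_col A = n" using A by (auto simp: is_graph_def)
  have inf: "infinite (Var - elements_mat A)"
    by (rule Diff_infinite_finite[OF finite_elements_mat infinite_Var])
  obtain f where f: "inj_on f (elements_mat A)" "f ` elements_mat A \<subseteq> Var - elements_mat A"
    using ex_inj_into_infinite[OF finite_elements_mat[of A] inf] by (elim exE conjE)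
  define A1 where "A1 = mat n n (\<lambda>(i, j). if i = j then f (A $$ (i, j)) else A $$ (i, j))"
  have el: "A $$ (i, j) \<in> elements_mat A" if "i < n" "j < n" for i j
    using that by (auto simp: elements_mat_iff)
  have fel: "f (A $$ (i, j)) \<in> Var" "f (A $$ (i, j)) \<notin> elements_mat A" if "i < n" "j < n" for i j
    using f(2) el[OF that] by auto
  have A1: "diagonal_subst A A1"
    unfolding diagonal_subst_def
  proof (intro conjI allI impI)
    fix i s t assume "i < dim_row A" "s < dim_row A" "t < dim_row A" "s \<noteq> t"
    then show "A1 $$ (i, i) \<noteq> A $$ (s, t)"
      using fel(2)[of i i] el[of s t] by (auto simp: A1_def)
  qed (simp_all add: A1_def inj_on_eq_iff[OF f(1)] el fel)
  obtain As where As: "As 0 = A1" "\<And>i. equiv_var_subst (As i ^\<^sub>m 2) (As (Suc i))"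
    using dependent_nat_choice[of "\<lambda>i M. i = 0 \<longrightarrow> M = A1" "\<lambda>i M N. equiv_var_subst (M ^\<^sub>m 2) N"]
      ex_equiv_var_subst by auto
  have "SaS A (\<lambda>i. As (i - 1))"
    unfolding SaS_def using A1 As(1) As(2)
    by (auto simp: gr0_conv_Suc Suc_le_eq)
  then show ?thesis by (intro exI[where x = "\<lambda>i. As (i - 1)"])
qed

lemma coarser_gdim_le:
  assumes "A \<rightarrowtail> B"
  shows "gdim A \<le> gdim B"
proof -
  define P where "P b p \<longleftrightarrow> fst p < dim_row B \<and> snd p < dim_col B \<and> B $$ p = b" for b p
  define f where "f b = A $$ (SOME p. P b p)" for b
  have d: "dim_row A = dim_row B" "dim_col A = dim_col B"
    using assms by (simp_all add: coarser_def)
  have f: "f (B $$ (i, j)) = A $$ (i, j)" if ij: "i < dim_row B" "j < dim_col B" for i j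
  proof -
    obtain s t where st: "(SOME p. P (B $$ (i, j)) p) = (s, t)" by (rule prod.exhaust)
    have "P (B $$ (i, j)) (i, j)" using ij by (simp add: P_def)
    then have "P (B $$ (i, j)) (SOME p. P (B $$ (i, j)) p)" by (rule someI)
    then have "P (B $$ (i, j)) (s, t)" by (simp only: st)
    then have "s < dim_row B" "t < dim_col B" "B $$ (s, t) = B $$ (i, j)" by (simp_all add: P_def)
    then have "A $$ (s, t) = A $$ (i, j)" using assms ij unfolding coarser_def by blast
    then show ?thesis by (simp only: f_def st)
  qed
  have "elements_mat A \<subseteq> f ` elements_mat B"
  proof
    fix b assume "b \<in> elements_mat A"
    then obtain i j where ij: "i < dim_row B" "j < dim_col B" "b = A $$ (i, j)"
      unfolding elements_mat_iff d by blast
    then have "b = f (B $$ (i, j))" by (simp only: f)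
    moreover have "B $$ (i, j) \<in> elements_mat B"
      using ij unfolding elements_mat_iff by blast
    ultimately show "b \<in> f ` elements_mat B" by (rule image_eqI)
  qed
  then show ?thesis unfolding gdim_def by (rule surj_card_le[OF finite_elements_mat])
qed

lemma coeff_Gam:
  assumes "i < dim_row G" "j < dim_row G" "k < dim_row G"
  shows "coeff (Gam G $$ (i, j)) k = (G ^\<^sub>m k) $$ (i, j)"
proof -
  have *: "[:0, 1:] ^ l * [:c:] = monom c l" for c :: xpoly and l
    by (simp add: monom_altdef mult.commute)
  have "coeff (Gam G $$ (i, j)) k = (\<Sum>l < dim_row G. coeff (monom ((G ^\<^sub>m l) $$ (i, j)) l) k)"
    unfolding Gam_def using assms by (simp only: index_mat prod.case coeff_sum *)
  also have "\<dots> = (\<Sum>l < dim_row G. if l = k then (G ^\<^sub>m l) $$ (i, j) else 0)"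
    by (intro sum.cong) simp_all
  finally show ?thesis using assms by simp
qed

lemma description_graph_coarser:
  assumes "G \<in> carrier_mat n n" "description_graph G D"
  shows "G \<rightarrowtail> D \<and> D \<in> carrier_mat n n"
proof -
  have D: "D \<in> carrier_mat n n" and
    e: "\<And>i j s t. i < n \<Longrightarrow> j < n \<Longrightarrow> s < n \<Longrightarrow> t < n \<Longrightarrow>
        D $$ (i, j) = D $$ (s, t) \<longleftrightarrow> Gam G $$ (i, j) = Gam G $$ (s, t)"
    using assms by (auto simp: description_graph_def equiv_var_subst_def Gam_def)
  have "G $$ (i, j) = G $$ (s, t)"
    if *: "i < n" "j < n" "s < n" "t < n" "D $$ (i, j) = D $$ (s, t)" for i j s t
  proof (cases "n \<le> 1")
    case True
    then have "i = s" "j = t" using * by simp_all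
    then show ?thesis by simp
  next
    case False
    have "coeff (Gam G $$ (i, j)) 1 = coeff (Gam G $$ (s, t)) 1" using e * by simp
    then show ?thesis using * False assms(1) by (simp add: coeff_Gam)
  qed
  moreover have "dim_row D = n" "dim_col D = n" "dim_row G = n" "dim_col G = n"
    using D assms(1) by auto
  ultimately have "G \<rightarrowtail> D" unfolding coarser_def by metis
  then show ?thesis using D by (rule conjI)
qed

lemma ex_stable_graph:
  assumes A: "is_graph n A"
  shows "\<exists>S. stable_graph A S"
proof -
  obtain B where B: "B 0 = A" "\<And>k. description_graph (B k) (B (Suc k))"
    using dependent_nat_choice[of "\<lambda>i M. i = 0 \<longrightarrow> M = A" "\<lambda>i. description_graph"]
      ex_equiv_var_subst by (auto simp: description_graph_def)
  have car: "B k \<in> carrier_mat n n" for k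
    by (induction k) (use A B description_graph_coarser in \<open>auto simp: is_graph_def\<close>)
  have le: "gdim (B k) \<le> gdim (B (Suc k))" for k
    using coarser_gdim_le description_graph_coarser[OF car B(2)] by blast
  have bound: "gdim (B k) \<le> n * n" for k
  proof -
    have "elements_mat (B k) \<subseteq> (\<lambda>p. B k $$ p) ` ({..<n} \<times> {..<n})"
    proof
      fix b assume "b \<in> elements_mat (B k)"
      then obtain i j where "i < n" "j < n" "b = B k $$ (i, j)"
        using car[of k] unfolding elements_mat_iff by auto
      then show "b \<in> (\<lambda>p. B k $$ p) ` ({..<n} \<times> {..<n})" by blast
    qed
    then have "gdim (B k) \<le> card ({..<n} \<times> {..<n})"
      unfolding gdim_def by (rule surj_card_le[rotated]) simp
    then show ?thesis by simp
  qed
  have ex: "\<exists>t. gdim (B t) = gdim (B (Suc t))"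
  proof (rule ccontr)
    assume "\<nexists>t. gdim (B t) = gdim (B (Suc t))"
    then have less: "gdim (B k) < gdim (B (Suc k))" for k using le[of k] by (simp add: le_less)
    have "k \<le> gdim (B k)" for k
      by (induction k) (use less Suc_leI le_less_trans in \<open>auto intro: Suc_leI le_less_trans\<close>)
    then show False using bound[of "Suc (n * n)"] by (meson Suc_n_not_le_n le_trans)
  qed
  define t where "t = (LEAST t. gdim (B t) = gdim (B (Suc t)))"
  have "stable_graph A (B t)"
    unfolding stable_graph_def
    using B LeastI_ex[OF ex, folded t_def] not_less_Least[of _ "\<lambda>t. gdim (B t) = gdim (B (Suc t))", folded t_def]
    by blast
  then show ?thesis ..
qed

end

theory Submission
  imports Defs "HOL-Library.Multiset"
begin

text \<open>
  An entry of the square of a matrix of variables determines the multiset of unordered pairs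
  \<open>{G\<^sub>i\<^sub>k, G\<^sub>k\<^sub>j}\<close>, and if vertices are recognized, the pairs involving a diagonal entry give back
  \<open>G\<^sub>i\<^sub>j\<close>. Hence the SaS process refines. If the square of \<open>G\<close> is coarser than \<open>G\<close>, then the
  matrices coarser than \<open>G\<close> are closed under the Jordan product \<open>CD + DC\<close>, hence under powers.
  So \<open>G\<close> is an upper bound for every matrix derived by powers from a matrix coarser than \<open>G\<close>.
  This applies both to \<open>G = A\<^sub>t\<close> and to the stable graph, and each of them is therefore coarser than
  the other.
\<close>

section \<open>The refinement preorder on matrices\<close>

lemma coarser_iff:
  assumes "A \<in> carrier_mat n n" "B \<in> carrier_mat n n"
  shows "A \<rightarrowtail> B \<longleftrightarrow> (\<forall>i<n. \<forall>j<n. \<forall>s<n. \<forall>t<n. B $$ (i, j) = B $$ (s, t) \<longrightarrow> A $$ (i, j) = A $$ (s, t))"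
  unfolding coarser_def carrier_matD[OF assms(1)] carrier_matD[OF assms(2)] by blast

lemma coarser_dims: "A \<rightarrowtail> B \<Longrightarrow> dim_row A = dim_row B" "A \<rightarrowtail> B \<Longrightarrow> dim_col A = dim_col B"
  unfolding coarser_def by (elim conjE, assumption)+

lemma coarser_refl: "A \<rightarrowtail> A"
  unfolding coarser_def by (intro conjI allI impI refl) assumption

lemma coarser_trans:
  assumes "A \<rightarrowtail> B" "B \<rightarrowtail> C"
  shows "A \<rightarrowtail> C"
proof -
  have d: "dim_row A = dim_row C" "dim_col A = dim_col C" "dim_row B = dim_row C" "dim_col B = dim_col C"
    using assms by (simp_all only: coarser_dims)
  show ?thesis
    unfolding coarser_def
  proof (intro conjI allI impI d(1,2))
    fix i j s t
    assume ij: "i < dim_row C" "j < dim_col C" "s < dim_row C" "t < dim_col C" "C $$ (i, j) = C $$ (s, t)"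
    then have "B $$ (i, j) = B $$ (s, t)" using assms(2) unfolding coarser_def by blast
    moreover have "i < dim_row B" "j < dim_col B" "s < dim_row B" "t < dim_col B"
      using ij(1-4) by (simp_all only: d)
    ultimately show "A $$ (i, j) = A $$ (s, t)" using assms(1) unfolding coarser_def by blast
  qed
qed

text \<open>The value of \<open>f\<close> is read off \<open>A\<close> at any position where
  \<open>B\<close> has the given entry; the choice is harmless because \<open>A\<close> is constant
  on the level sets of \<open>B\<close>. This turns refinement into a map between entries.\<close>

lemma coarser_factor:
  assumes "A \<rightarrowtail> B"
  obtains f where "\<And>i j. i < dim_row B \<Longrightarrow> j < dim_col B \<Longrightarrow> A $$ (i, j) = f (B $$ (i, j))"
proof -
  define P where "P b p \<longleftrightarrow> fst p < dim_row B \<and> snd p < dim_col B \<and> B $$ p = b" for b p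
  define f where "f b = A $$ (SOME p. P b p)" for b
  have "A $$ (i, j) = f (B $$ (i, j))" if ij: "i < dim_row B" "j < dim_col B" for i j
  proof -
    obtain s t where st: "(SOME p. P (B $$ (i, j)) p) = (s, t)" by (rule prod.exhaust)
    have "P (B $$ (i, j)) (i, j)" using ij by (simp add: P_def)
    then have "P (B $$ (i, j)) (SOME p. P (B $$ (i, j)) p)" by (rule someI)
    then have "s < dim_row B" "t < dim_col B" "B $$ (s, t) = B $$ (i, j)"
      unfolding st by (simp_all add: P_def)
    then have "A $$ (s, t) = A $$ (i, j)" using assms ij unfolding coarser_def by blast
    then show ?thesis by (simp only: f_def st)
  qed
  then show ?thesis by (rule that)
qed

text \<open>The factor map sends the finite set of entries of \<open>B\<close> onto that of
  \<open>A\<close>; equal cardinalities make it injective, which reverses the refinement.\<close>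

lemma coarser_gdim_eq:
  assumes "A \<rightarrowtail> B" "gdim A = gdim B"
  shows "B \<rightarrowtail> A"
proof -
  obtain f where f: "\<And>i j. i < dim_row B \<Longrightarrow> j < dim_col B \<Longrightarrow> A $$ (i, j) = f (B $$ (i, j))"
    using coarser_factor[OF assms(1)] by metis
  have d: "dim_row A = dim_row B" "dim_col A = dim_col B"
    using assms(1) by (simp_all only: coarser_dims)
  have el: "B $$ (i, j) \<in> elements_mat B" if "i < dim_row B" "j < dim_col B" for i j
    using that unfolding elements_mat_iff by blast
  have "elements_mat A = f ` elements_mat B"
    unfolding set_eq_iff elements_mat_iff image_iff Bex_def d using f by metis
  then have "inj_on f (elements_mat B)"
    using assms(2) by (intro eq_card_imp_inj_on finite_elements_mat) (simp add: gdim_def)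
  then show ?thesis
    unfolding coarser_def d using f el by (metis inj_on_eq_iff)
qed

lemma equiv_var_subst_imp_equivalent:
  assumes "equiv_var_subst M N"
  shows "M \<approx>\<^sub>g N"
proof -
  have d: "dim_row N = dim_row M" "dim_col N = dim_col M"
    using assms unfolding equiv_var_subst_def by blast+
  have e: "N $$ (i, j) = N $$ (s, t) \<longleftrightarrow> M $$ (i, j) = M $$ (s, t)"
    if "i < dim_row M" "j < dim_col M" "s < dim_row M" "t < dim_col M" for i j s t
    using assms that unfolding equiv_var_subst_def by blast
  show ?thesis
    unfolding equivalent_mats_def coarser_def d by (intro conjI allI impI refl) (simp_all only: e)
qed

text \<open>The target \<open>range xvar\<close> also contains \<open>xvar 0\<close>, so that the
  same condition covers \<open>A\<close> itself and the off-diagonal entries of the first SaS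
  term.\<close>

lemma equiv_var_subst_elements: "equiv_var_subst M N \<Longrightarrow> elements_mat N \<subseteq> range xvar"
  unfolding equiv_var_subst_def Var_def by blast

section \<open>Entries of a square as multisets of walks\<close>

lemma pow_mat_2: "G \<in> carrier_mat n n \<Longrightarrow> G ^\<^sub>m 2 = G * G"
  by (simp add: numeral_2_eq_2)

lemma mult_mat_entry:
  assumes "A \<in> carrier_mat n n" "B \<in> carrier_mat n n" "i < n" "j < n"
  shows "(A * B) $$ (i, j) = (\<Sum>k<n. A $$ (i, k) * B $$ (k, j))"
  using assms by (auto simp: scalar_prod_def atLeast0LessThan)

text \<open>The coefficient at \<open>x\<close> counts the \<open>k\<close> with
  \<open>m k = x\<close>. Since the coefficients lie in characteristic zero, the count is recovered
  exactly.\<close>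

lemma sum_single_eqD:
  assumes "finite K" "(\<Sum>k\<in>K. Poly_Mapping.single (m k) (1::real)) = (\<Sum>k\<in>K. Poly_Mapping.single (m' k) 1)"
  shows "image_mset m (mset_set K) = image_mset m' (mset_set K)"
proof (rule multiset_eqI)
  fix x
  have card: "Poly_Mapping.lookup (\<Sum>k\<in>K. Poly_Mapping.single (g k) (1::real)) x
      = real (count (image_mset g (mset_set K)) x)" for g :: "'a \<Rightarrow> 'b"
    using assms(1)
    by (induction K rule: finite_induct) (simp_all add: lookup_add lookup_single when_def)
  show "count (image_mset m (mset_set K)) x = count (image_mset m' (mset_set K)) x"
    using card[of m] card[of m'] assms(2) by simp
qed

text \<open>Identifies a monomial with the multiset of its indeterminates: the exponent of
  \<open>x\<close> is the multiplicity of \<open>x\<close>.\<close>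

lemma inj_sum_mset_single:
  "inj (\<lambda>M. \<Sum>x\<in>#M. Poly_Mapping.single x (1::nat))"
proof (rule injI, rule multiset_eqI)
  have l: "Poly_Mapping.lookup (\<Sum>y\<in>#M. Poly_Mapping.single y (1::nat)) x = count M x" for M and x :: 'a
    by (induction M) (simp_all add: lookup_add lookup_single when_def)
  show "count M x = count N x"
    if "(\<Sum>x\<in>#M. Poly_Mapping.single x (1::nat)) = (\<Sum>x\<in>#N. Poly_Mapping.single x 1)" for M N and x :: 'a
    using that l by metis
qed

text \<open>Records the label pairs along the walks of length two from \<open>i\<close> to
  \<open>j\<close>. The pairs are unordered because the indeterminates commute.\<close>

definition paths2 :: "'a mat \<Rightarrow> nat \<Rightarrow> nat \<Rightarrow> 'a multiset multiset" where
  "paths2 G i j = image_mset (\<lambda>k. {#G $$ (i, k), G $$ (k, j)#}) (mset_set {..<dim_row G})"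

text \<open>Each walk contributes one quadratic monomial with coefficient 1, so nothing cancels. The
  polynomial determines these monomials with multiplicity, and each monomial determines its
  unordered pair of labels.\<close>

lemma paths2_eqI:
  assumes G: "G \<in> carrier_mat n n" "elements_mat G \<subseteq> range xvar"
    and ij: "i < n" "j < n" "s < n" "t < n"
    and eq: "(G ^\<^sub>m 2) $$ (i, j) = (G ^\<^sub>m 2) $$ (s, t)"
  shows "paths2 G i j = paths2 G s t"
proof -
  define c where "c i j = inv_into UNIV xvar (G $$ (i, j))" for i j
  have c: "G $$ (i, j) = xvar (c i j)" if "i < n" "j < n" for i j
  proof -
    have "G $$ (i, j) \<in> elements_mat G" using G(1) that unfolding elements_mat_iff by auto
    then show ?thesis using G(2) by (auto simp: c_def f_inv_into_f)
  qed
  \<comment> \<open>The exponent vector of the monomial whose indeterminates have the indices in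
    \<open>M\<close>.\<close>
  define \<phi> where "\<phi> M = (\<Sum>x\<in>#M. Poly_Mapping.single x (1::nat))" for M :: "nat multiset"
  have inj: "inj \<phi>" unfolding \<phi>_def by (rule inj_sum_mset_single)
  have sq: "(G ^\<^sub>m 2) $$ (i, j) = (\<Sum>k<n. Poly_Mapping.single (\<phi> {#c i k, c k j#}) 1)"
    if "i < n" "j < n" for i j
    using that G(1)
    by (simp add: pow_mat_2 mult_mat_entry c xvar_def mult_single \<phi>_def del: index_mult_mat)
  have "image_mset (\<lambda>k. \<phi> {#c i k, c k j#}) (mset_set {..<n})
      = image_mset (\<lambda>k. \<phi> {#c s k, c k t#}) (mset_set {..<n})"
    using eq by (intro sum_single_eqD) (simp_all add: sq ij)
  then have "image_mset \<phi> (image_mset (\<lambda>k. {#c i k, c k j#}) (mset_set {..<n}))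
      = image_mset \<phi> (image_mset (\<lambda>k. {#c s k, c k t#}) (mset_set {..<n}))"
    by (simp add: image_mset.compositionality comp_def)
  then have "image_mset (\<lambda>k. {#c i k, c k j#}) (mset_set {..<n})
      = image_mset (\<lambda>k. {#c s k, c k t#}) (mset_set {..<n})"
    by (rule injD[OF multiset.inj_map[OF inj]])
  \<comment> \<open>Passes from indices back to the labels themselves.\<close>
  then have "image_mset (image_mset xvar) (image_mset (\<lambda>k. {#c i k, c k j#}) (mset_set {..<n}))
      = image_mset (image_mset xvar) (image_mset (\<lambda>k. {#c s k, c k t#}) (mset_set {..<n}))"
    by simp
  moreover have "paths2 G i j
      = image_mset (image_mset xvar) (image_mset (\<lambda>k. {#c i k, c k j#}) (mset_set {..<n}))"
    if "i < n" "j < n" for i j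
    unfolding paths2_def image_mset.compositionality comp_def carrier_matD(1)[OF G(1)]
    using that by (intro image_mset_cong) (simp add: c)
  ultimately show ?thesis using ij by simp
qed

section \<open>Squaring refines graphs that recognize vertices\<close>

lemma recognizes_vertices_iff:
  assumes "G \<in> carrier_mat n n"
  shows "recognizes_vertices G \<longleftrightarrow> (\<forall>i<n. \<forall>s<n. \<forall>t<n. s \<noteq> t \<longrightarrow> G $$ (i, i) \<noteq> G $$ (s, t))"
  unfolding recognizes_vertices_def carrier_matD[OF assms] by (rule refl)

lemma recognizes_vertices_coarser:
  assumes "recognizes_vertices A" "A \<rightarrowtail> B" "A \<in> carrier_mat n n"
  shows "recognizes_vertices B"
proof -
  have B: "B \<in> carrier_mat n n" using assms(2,3) coarser_dims[OF assms(2)] by (intro carrier_matI) simp_all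
  show ?thesis
    using assms(1,2) unfolding recognizes_vertices_iff[OF B] recognizes_vertices_iff[OF assms(3)]
      coarser_iff[OF assms(3) B] by blast
qed

text \<open>The walk \<open>i\<close>, \<open>i\<close>, \<open>i\<close> gives a pair of two
  diagonal labels. A walk \<open>s\<close>, \<open>k\<close>, \<open>t\<close> with the same pair
  has both labels on the diagonal, hence \<open>s = k = t\<close>.\<close>

lemma paths2_diag:
  assumes G: "G \<in> carrier_mat n n" "recognizes_vertices G"
    and ij: "i < n" "s < n" "t < n"
    and eq: "paths2 G i i = paths2 G s t"
  shows "s = t \<and> G $$ (i, i) = G $$ (s, t)"
proof -
  note rv = G(2)[unfolded recognizes_vertices_iff[OF G(1)], rule_format]
  have "{#G $$ (i, i), G $$ (i, i)#} \<in># paths2 G i i"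
    using G(1) ij by (auto simp: paths2_def)
  then have "{#G $$ (i, i), G $$ (i, i)#} \<in># paths2 G s t" by (simp only: eq)
  then obtain k where "k < n" "{#G $$ (i, i), G $$ (i, i)#} = {#G $$ (s, k), G $$ (k, t)#}"
    using G(1) by (auto simp: paths2_def)
  then have "k < n" "G $$ (i, i) = G $$ (s, k)" "G $$ (i, i) = G $$ (k, t)"
    by (auto simp: add_eq_conv_ex)
  then show ?thesis using rv ij by metis
qed

text \<open>The walk \<open>i\<close>, \<open>i\<close>, \<open>j\<close> gives a pair containing a
  diagonal label. A walk \<open>s\<close>, \<open>k\<close>, \<open>t\<close> with the same pair
  must have \<open>k = s\<close> or \<open>k = t\<close>, and its other label is then the entry at
  \<open>(s, t)\<close>.\<close>

lemma paths2_offdiag: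
  assumes G: "G \<in> carrier_mat n n" "recognizes_vertices G"
    and ij: "i < n" "j < n" "s < n" "t < n" "i \<noteq> j" "s \<noteq> t"
    and eq: "paths2 G i j = paths2 G s t"
  shows "G $$ (i, j) = G $$ (s, t)"
proof -
  note rv = G(2)[unfolded recognizes_vertices_iff[OF G(1)], rule_format]
  have "{#G $$ (i, i), G $$ (i, j)#} \<in># paths2 G i j"
    using G(1) ij by (auto simp: paths2_def)
  then have "{#G $$ (i, i), G $$ (i, j)#} \<in># paths2 G s t" by (simp only: eq)
  then obtain k where "k < n" "{#G $$ (i, i), G $$ (i, j)#} = {#G $$ (s, k), G $$ (k, t)#}"
    using G(1) by (auto simp: paths2_def)
  then have k: "k < n" "G $$ (i, i) = G $$ (s, k) \<and> G $$ (i, j) = G $$ (k, t)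
      \<or> G $$ (i, i) = G $$ (k, t) \<and> G $$ (i, j) = G $$ (s, k)"
    by (auto simp: add_eq_conv_ex)
  then show ?thesis using rv ij by metis
qed

lemma square_refines:
  assumes G: "G \<in> carrier_mat n n" "elements_mat G \<subseteq> range xvar" "recognizes_vertices G"
  shows "G \<rightarrowtail> G ^\<^sub>m 2" "recognizes_vertices (G ^\<^sub>m 2)"
proof -
  have sq: "G ^\<^sub>m 2 \<in> carrier_mat n n" using G(1) by simp
  have "G $$ (i, j) = G $$ (s, t)"
    if ij: "i < n" "j < n" "s < n" "t < n" "(G ^\<^sub>m 2) $$ (i, j) = (G ^\<^sub>m 2) $$ (s, t)" for i j s t
  proof -
    have eq: "paths2 G i j = paths2 G s t" using paths2_eqI[OF G(1,2) ij] .
    \<comment> \<open>The two uses of \<open>paths2_diag\<close> treat the cases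
      \<open>i = j\<close> and \<open>s = t\<close>; otherwise both positions are off the
      diagonal.\<close>
    then show ?thesis
      using paths2_diag[OF G(1,3), of i s t] paths2_diag[OF G(1,3), of s i j]
        paths2_offdiag[OF G(1,3), of i j s t] ij by metis
  qed
  then show "G \<rightarrowtail> G ^\<^sub>m 2" unfolding coarser_iff[OF G(1) sq] by blast
  then show "recognizes_vertices (G ^\<^sub>m 2)"
    using recognizes_vertices_coarser G by blast
qed

section \<open>Closure under Jordan products and powers\<close>

text \<open>A single product \<open>C * D\<close> depends on the order of the labels along a walk,
  which \<open>paths2\<close> forgets. The symmetrized product depends only on unordered pairs, so
  its entry is a function of \<open>paths2 S i j\<close>, and that multiset is determined by the
  entry of \<open>S\<close> because the square is coarser than \<open>S\<close>.\<close>

lemma jordan_product_coarser: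
  fixes C D :: "'a :: comm_ring_1 mat"
  assumes S: "S \<in> carrier_mat n n" "elements_mat S \<subseteq> range xvar" "S ^\<^sub>m 2 \<rightarrowtail> S"
    and CD: "C \<in> carrier_mat n n" "D \<in> carrier_mat n n" "C \<rightarrowtail> S" "D \<rightarrowtail> S"
  shows "C * D + D * C \<rightarrowtail> S"
proof -
  obtain f where f: "\<And>i j. i < n \<Longrightarrow> j < n \<Longrightarrow> C $$ (i, j) = f (S $$ (i, j))"
    using coarser_factor[OF CD(3)] S(1) by auto
  obtain g where g: "\<And>i j. i < n \<Longrightarrow> j < n \<Longrightarrow> D $$ (i, j) = g (S $$ (i, j))"
    using coarser_factor[OF CD(4)] S(1) by auto
  \<comment> \<open>so that \<open>H {#a, b#} = f a * g b + f b * g a\<close>\<close>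
  define H where "H M = (\<Sum>a\<in>#M. \<Sum>b\<in># M - {#a#}. f a * g b)" for M
  have H: "(C * D + D * C) $$ (i, j) = (\<Sum>M\<in>#paths2 S i j. H M)" if "i < n" "j < n" for i j
  proof -
    have "(\<Sum>M\<in>#paths2 S i j. H M) = (\<Sum>k<n. H {#S $$ (i, k), S $$ (k, j)#})"
      using S(1) by (simp add: paths2_def image_mset.compositionality comp_def sum_unfold_sum_mset)
    also have "\<dots> = (\<Sum>k<n. C $$ (i, k) * D $$ (k, j) + D $$ (i, k) * C $$ (k, j))"
      using that by (intro sum.cong) (simp_all add: H_def f g algebra_simps)
    also have "\<dots> = (C * D) $$ (i, j) + (D * C) $$ (i, j)"
      using that CD by (simp add: mult_mat_entry sum.distrib del: index_mult_mat)
    also have "\<dots> = (C * D + D * C) $$ (i, j)" using that CD by simp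
    finally show ?thesis by (rule sym)
  qed
  have sq: "S ^\<^sub>m 2 \<in> carrier_mat n n" using S(1) by simp
  have "(C * D + D * C) $$ (i, j) = (C * D + D * C) $$ (s, t)"
    if ij: "i < n" "j < n" "s < n" "t < n" "S $$ (i, j) = S $$ (s, t)" for i j s t
  proof -
    have "(S ^\<^sub>m 2) $$ (i, j) = (S ^\<^sub>m 2) $$ (s, t)"
      using S(3) ij unfolding coarser_iff[OF sq S(1)] by blast
    then have "paths2 S i j = paths2 S s t" using paths2_eqI[OF S(1,2) ij(1-4)] by blast
    then show ?thesis using H ij by simp
  qed
  moreover have "C * D + D * C \<in> carrier_mat n n" using CD by simp
  ultimately show ?thesis using coarser_iff S(1) by blast
qed

lemma one_mat_coarser:
  assumes "S \<in> carrier_mat n n" "recognizes_vertices S"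
  shows "(1\<^sub>m n :: 'a :: zero_neq_one mat) \<rightarrowtail> S"
  unfolding coarser_iff[OF one_carrier_mat assms(1)]
proof (intro allI impI)
  fix i j s t assume ij: "i < n" "j < n" "s < n" "t < n" "S $$ (i, j) = S $$ (s, t)"
  then have "i = j \<longleftrightarrow> s = t"
    using assms(2)[unfolded recognizes_vertices_iff[OF assms(1)]] by metis
  then show "(1\<^sub>m n :: 'a mat) $$ (i, j) = 1\<^sub>m n $$ (s, t)" using ij by simp
qed

text \<open>Since \<open>C\<close> commutes with its powers, its Jordan product with the
  \<open>k\<close>-th power is twice the next power, and the factor 2 cancels in a domain of
  characteristic zero. Vertex recognition supplies the zeroth power.\<close>

lemma pow_mat_coarser:
  fixes C :: "'a :: {idom, ring_char_0} mat"
  assumes S: "S \<in> carrier_mat n n" "elements_mat S \<subseteq> range xvar" "S ^\<^sub>m 2 \<rightarrowtail> S" "recognizes_vertices S"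
    and C: "C \<in> carrier_mat n n" "C \<rightarrowtail> S"
  shows "C ^\<^sub>m k \<rightarrowtail> S"
proof (induction k)
  case 0
  then show ?case using one_mat_coarser[OF S(1,4)] C(1) by simp
next
  case (Suc k)
  have P: "C ^\<^sub>m k \<in> carrier_mat n n" "C ^\<^sub>m Suc k \<in> carrier_mat n n"
    using C(1) by (auto intro: mult_carrier_mat)
  have comm: "C * C ^\<^sub>m k = C ^\<^sub>m k * C"
    by (induction k) (use C(1) in \<open>simp_all add: assoc_mult_mat[of _ n n _ n _ n, symmetric]\<close>)
  have J: "C ^\<^sub>m k * C + C * C ^\<^sub>m k \<rightarrowtail> S"
    by (rule jordan_product_coarser[OF S(1-3) P(1) C(1) Suc C(2)])
  have JC: "C ^\<^sub>m k * C + C * C ^\<^sub>m k \<in> carrier_mat n n" using C(1) P(1) by simp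
  have two: "(C ^\<^sub>m k * C + C * C ^\<^sub>m k) $$ (i, j) = 2 * (C ^\<^sub>m Suc k) $$ (i, j)"
    if "i < n" "j < n" for i j
  proof -
    have "(C ^\<^sub>m k * C + C * C ^\<^sub>m k) $$ (i, j) = (C ^\<^sub>m k * C) $$ (i, j) + (C ^\<^sub>m k * C) $$ (i, j)"
      unfolding comm using C(1) P(1) that by simp
    then show ?thesis by simp
  qed
  show ?case
    unfolding coarser_iff[OF P(2) S(1)]
  proof (intro allI impI)
    fix i j s t assume ij: "i < n" "j < n" "s < n" "t < n" "S $$ (i, j) = S $$ (s, t)"
    then have "2 * (C ^\<^sub>m Suc k) $$ (i, j) = 2 * (C ^\<^sub>m Suc k) $$ (s, t)"
      using J unfolding coarser_iff[OF JC S(1)] by (metis two)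
    then show "(C ^\<^sub>m Suc k) $$ (i, j) = (C ^\<^sub>m Suc k) $$ (s, t)"
      by (rule mult_left_cancel[OF zero_neq_numeral[symmetric], THEN iffD1])
  qed
qed

section \<open>Powers and the description matrix\<close>

lemma Gam_carrier: "G \<in> carrier_mat n n \<Longrightarrow> Gam G \<in> carrier_mat n n"
  by (simp add: Gam_def)

text \<open>The power is read off as the coefficient of \<open>\<lambda>^k\<close>;
  \<open>Gam\<close> stops at exponent \<open>n - 1\<close>, whence the bound on
  \<open>k\<close>.\<close>

lemma pow_coarser_Gam:
  assumes "G \<in> carrier_mat n n" "k < n"
  shows "G ^\<^sub>m k \<rightarrowtail> Gam G"
proof -
  have P: "G ^\<^sub>m k \<in> carrier_mat n n" using assms(1) by simp
  have "(G ^\<^sub>m k) $$ (i, j) = coeff (Gam G $$ (i, j)) k" if "i < n" "j < n" for i j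
    using that assms coeff_Gam[of i G j k] by simp
  then show ?thesis unfolding coarser_iff[OF P Gam_carrier[OF assms(1)]] by simp
qed

lemma Gam_coarser:
  assumes "G \<in> carrier_mat n n" "S \<in> carrier_mat n n" "\<And>k. G ^\<^sub>m k \<rightarrowtail> S"
  shows "Gam G \<rightarrowtail> S"
proof -
  have P: "G ^\<^sub>m k \<in> carrier_mat n n" for k using assms(1) by simp
  have Gam: "Gam G $$ (i, j) = (\<Sum>k<n. [:0, 1:] ^ k * [:(G ^\<^sub>m k) $$ (i, j):])"
    if "i < n" "j < n" for i j
    using that by (simp only: Gam_def carrier_matD[OF assms(1)] index_mat prod.case)
  show ?thesis
    unfolding coarser_iff[OF Gam_carrier[OF assms(1)] assms(2)]
  proof (intro allI impI)
    fix i j s t assume ij: "i < n" "j < n" "s < n" "t < n" "S $$ (i, j) = S $$ (s, t)"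
    have pow: "(G ^\<^sub>m k) $$ (i, j) = (G ^\<^sub>m k) $$ (s, t)" for k
      using assms(3)[of k] ij unfolding coarser_iff[OF P assms(2)] by blast
    show "Gam G $$ (i, j) = Gam G $$ (s, t)"
      unfolding Gam[OF ij(1,2)] Gam[OF ij(3,4)] pow by (rule refl)
  qed
qed

text \<open>For order 2 the square does not occur in \<open>Gam G\<close>; the Cayley-Hamilton identity replaces it.\<close>

lemma square_coarser_of_Gam_coarser:
  assumes S: "S \<in> carrier_mat n n" and Gam: "Gam S \<rightarrowtail> S"
  shows "S ^\<^sub>m 2 \<rightarrowtail> S" "recognizes_vertices S"
proof -
  have pow: "S ^\<^sub>m k \<rightarrowtail> S" if "k < n" for k
    using coarser_trans[OF pow_coarser_Gam[OF S that] Gam] .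
  have sq: "S ^\<^sub>m 2 \<in> carrier_mat n n" using S by simp
  show rv: "recognizes_vertices S"
  proof (cases "n = 0")
    case True
    then show ?thesis using S by (simp add: recognizes_vertices_def)
  next
    case False
    \<comment> \<open>For positive order the constant coefficient of \<open>Gam\<close> is the
      identity, which separates the diagonal from the rest; every refinement of it inherits
      this.\<close>
    then have "(1\<^sub>m n :: xpoly mat) \<rightarrowtail> S" using pow[of 0] S by simp
    moreover have "recognizes_vertices (1\<^sub>m n :: xpoly mat)" by (simp add: recognizes_vertices_def)
    ultimately show ?thesis using recognizes_vertices_coarser one_carrier_mat by blast
  qed
  \<comment> \<open>Up to order 1 there is at most one position to compare; above order 2 the square
    is itself a coefficient of \<open>Gam\<close>.\<close>
  consider "n \<le> 1" | "n = 2" | "2 < n" by linarith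
  then show "S ^\<^sub>m 2 \<rightarrowtail> S"
  proof cases
    case 1
    then have "i = 0" if "i < n" for i using that by simp
    then show ?thesis unfolding coarser_iff[OF sq S] by blast
  next
    case 2
    \<comment> \<open>Trace times \<open>S\<close> minus determinant times the identity: apart from
      two constants, only the entries of \<open>S\<close> and of the identity occur.\<close>
    have CH: "(S ^\<^sub>m 2) $$ (i, j) = (S $$ (0, 0) + S $$ (1, 1)) * S $$ (i, j)
        - (S $$ (0, 0) * S $$ (1, 1) - S $$ (0, 1) * S $$ (1, 0)) * 1\<^sub>m n $$ (i, j)"
      if "i < n" "j < n" for i j
    proof -
      have "i = 0 \<or> i = 1" "j = 0 \<or> j = 1" using that 2 by auto
      moreover have "(S ^\<^sub>m 2) $$ (i, j) = S $$ (i, 0) * S $$ (0, j) + S $$ (i, 1) * S $$ (1, j)"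
        unfolding pow_mat_2[OF S] mult_mat_entry[OF S S that] 2 by (simp add: numeral_2_eq_2)
      ultimately show ?thesis using 2 by (elim disjE) (simp_all add: algebra_simps)
    qed
    have "(1\<^sub>m n :: xpoly mat) \<rightarrowtail> S" by (rule one_mat_coarser[OF S rv])
    then show ?thesis
      unfolding coarser_iff[OF sq S] coarser_iff[OF one_carrier_mat S] by (metis CH)
  next
    case 3
    then show ?thesis by (rule pow)
  qed
qed

section \<open>The description sequence and the stable graph\<close>

lemma description_sequence:
  assumes "A \<in> carrier_mat n n" "B 0 = A" "\<And>k. description_graph (B k) (B (Suc k))"
  shows "B k \<in> carrier_mat n n \<and> A \<rightarrowtail> B k"
proof (induction k)
  case 0
  then show ?case using assms(1,2) coarser_refl by blast
next
  case (Suc k)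
  then show ?case using description_graph_coarser assms(3) coarser_trans by blast
qed

lemma stable_graph_props:
  assumes A: "is_graph n A" and S: "stable_graph A S"
  shows "S \<in> carrier_mat n n" "elements_mat S \<subseteq> range xvar" "A \<rightarrowtail> S" "Gam S \<rightarrowtail> S"
proof -
  obtain B t where B: "B 0 = A" "\<And>k. description_graph (B k) (B (Suc k))"
    "gdim (B t) = gdim (B (Suc t))" "S = B t"
    using S unfolding stable_graph_def by blast
  have car: "A \<in> carrier_mat n n" using A by (simp add: is_graph_def)
  show S: "S \<in> carrier_mat n n" "A \<rightarrowtail> S" using description_sequence[OF car B(1,2)] B(4) by auto
  show "elements_mat S \<subseteq> range xvar"
  proof (cases t)
    \<comment> \<open>Here \<open>S\<close> is \<open>A\<close> itself, so \<open>xvar 0\<close> may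
      occur among its entries.\<close>
    case 0
    then show ?thesis using A B(1,4) by (auto simp: is_graph_def Var_def)
  next
    case (Suc k)
    then show ?thesis using B(2)[of k] B(4) equiv_var_subst_elements
      unfolding description_graph_def by blast
  qed
  \<comment> \<open>Equal dimensions reverse the refinement from \<open>B t\<close> to its
    successor, so \<open>S\<close> is stable under forming \<open>Gam\<close>.\<close>
  have "B (Suc t) \<rightarrowtail> S"
    using coarser_gdim_eq B description_graph_coarser[OF S(1), of "B (Suc t)"] by metis
  moreover have "Gam S \<rightarrowtail> B (Suc t)"
    using B(2)[of t] B(4) equiv_var_subst_imp_equivalent
    unfolding description_graph_def equivalent_mats_def by blast
  ultimately show "Gam S \<rightarrowtail> S" by (rule coarser_trans[rotated])
qed

text \<open>By closure under powers, \<open>G\<close> bounds every term of the description sequence,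
  not only the stable one.\<close>

lemma stable_graph_coarser:
  assumes A: "is_graph n A" and S: "stable_graph A S"
    and G: "G \<in> carrier_mat n n" "elements_mat G \<subseteq> range xvar" "G ^\<^sub>m 2 \<rightarrowtail> G" "recognizes_vertices G"
    and AG: "A \<rightarrowtail> G"
  shows "S \<rightarrowtail> G"
proof -
  obtain B t where B: "B 0 = A" "\<And>k. description_graph (B k) (B (Suc k))" "S = B t"
    using S unfolding stable_graph_def by blast
  have car: "B k \<in> carrier_mat n n" for k
    using description_sequence[OF _ B(1,2)] A by (simp add: is_graph_def)
  have "B k \<rightarrowtail> G" for k
  proof (induction k)
    case 0
    then show ?case using AG B(1) by simp
  next
    case (Suc k)
    have "Gam (B k) \<rightarrowtail> G"
      by (intro Gam_coarser[OF car G(1)] pow_mat_coarser[OF G car Suc])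
    moreover have "B (Suc k) \<rightarrowtail> Gam (B k)"
      using B(2)[of k] equiv_var_subst_imp_equivalent
      unfolding description_graph_def equivalent_mats_def by blast
    ultimately show ?case using coarser_trans by blast
  qed
  then show ?thesis using B(3) by simp
qed

section \<open>The SaS process and its comparison with the stable graph\<close>

lemma diagonal_subst_props:
  assumes A: "is_graph n A" and A1: "diagonal_subst A A1"
  shows "A1 \<in> carrier_mat n n" "elements_mat A1 \<subseteq> range xvar" "recognizes_vertices A1" "A \<rightarrowtail> A1"
proof -
  have car: "A \<in> carrier_mat n n" using A by (simp add: is_graph_def)
  then show car1: "A1 \<in> carrier_mat n n" using A1 by (auto simp: diagonal_subst_def)
  have off: "A1 $$ (i, j) = A $$ (i, j)" if "i < n" "j < n" "i \<noteq> j" for i j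
    using A1 car that by (simp add: diagonal_subst_def)
  have diag: "A1 $$ (i, i) = A1 $$ (j, j) \<longleftrightarrow> A $$ (i, i) = A $$ (j, j)" if "i < n" "j < n" for i j
    using A1 car that by (simp add: diagonal_subst_def)
  have fresh: "A1 $$ (i, i) \<noteq> A $$ (s, t)" if "i < n" "s < n" "t < n" "s \<noteq> t" for i s t
    using A1 car that by (simp add: diagonal_subst_def)
  show "recognizes_vertices A1"
    unfolding recognizes_vertices_iff[OF car1] using off fresh by simp
  show "A \<rightarrowtail> A1"
    unfolding coarser_iff[OF car car1] using off diag fresh by metis
  show "elements_mat A1 \<subseteq> range xvar"
  proof
    fix x assume "x \<in> elements_mat A1"
    then obtain i j where ij: "i < n" "j < n" "x = A1 $$ (i, j)"
      using car1 by (auto simp: elements_mat_iff)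
    have "x \<in> {xvar 0} \<union> Var"
    proof (cases "i = j")
      case True
      then show ?thesis using A1 car ij by (simp add: diagonal_subst_def)
    next
      case False
      then have "x \<in> elements_mat A" using off ij car by (auto simp: elements_mat_iff)
      then show ?thesis using A by (auto simp: is_graph_def)
    qed
    then show "x \<in> range xvar" by (auto simp: Var_def)
  qed
qed

text \<open>Equal entries of \<open>S\<close> never mix a diagonal with an off-diagonal position,
  and within each kind \<open>A1\<close> has the same equalities as \<open>A\<close>. Thus
  \<open>A1\<close> is the coarsest refinement of \<open>A\<close> that recognizes vertices.\<close>

lemma diagonal_subst_coarser:
  assumes A: "is_graph n A" and A1: "diagonal_subst A A1"
    and S: "S \<in> carrier_mat n n" "recognizes_vertices S" "A \<rightarrowtail> S"
  shows "A1 \<rightarrowtail> S"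
proof -
  have car: "A \<in> carrier_mat n n" using A by (simp add: is_graph_def)
  have off: "A1 $$ (i, j) = A $$ (i, j)" if "i < n" "j < n" "i \<noteq> j" for i j
    using A1 car that by (simp add: diagonal_subst_def)
  have diag: "A1 $$ (i, i) = A1 $$ (j, j) \<longleftrightarrow> A $$ (i, i) = A $$ (j, j)" if "i < n" "j < n" for i j
    using A1 car that by (simp add: diagonal_subst_def)
  show ?thesis
    using S(2,3) unfolding coarser_iff[OF diagonal_subst_props(1)[OF A A1] S(1)]
      coarser_iff[OF car S(1)] recognizes_vertices_iff[OF S(1)]
    by (metis off diag)
qed

text \<open>The invariant that lets \<open>square_refines\<close> be applied at every term;
  refinement of \<open>A\<close> is passed on through the square.\<close>

lemma SaS_props:
  assumes A: "is_graph n A" and As: "SaS A As" and "i \<ge> 1"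
  shows "As i \<in> carrier_mat n n \<and> elements_mat (As i) \<subseteq> range xvar \<and> recognizes_vertices (As i) \<and> A \<rightarrowtail> As i"
  using \<open>i \<ge> 1\<close>
proof (induction i rule: dec_induct)
  case base
  then show ?case using diagonal_subst_props[OF A] As by (simp add: SaS_def)
next
  case (step i)
  then have G: "As i \<in> carrier_mat n n" "elements_mat (As i) \<subseteq> range xvar" "recognizes_vertices (As i)"
    "A \<rightarrowtail> As i" by auto
  have e: "equiv_var_subst (As i ^\<^sub>m 2) (As (Suc i))" using As step(1) by (simp add: SaS_def)
  then have c: "As i ^\<^sub>m 2 \<rightarrowtail> As (Suc i)"
    using equiv_var_subst_imp_equivalent unfolding equivalent_mats_def by blast
  have "As i ^\<^sub>m 2 \<in> carrier_mat n n" using G(1) by simp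
  moreover have "As (Suc i) \<in> carrier_mat n n" using e G(1) by (auto simp: equiv_var_subst_def)
  ultimately show ?case
    using square_refines[OF G(1-3)] c coarser_trans[OF G(4)] recognizes_vertices_coarser
      equiv_var_subst_elements[OF e] coarser_trans by metis
qed

lemma SaS_step:
  assumes A: "is_graph n A" and As: "SaS A As" and i: "i \<ge> 1"
  shows "As i \<rightarrowtail> As (i + 1)" "As i ^\<^sub>m 2 \<approx>\<^sub>g As (i + 1)"
proof -
  have "equiv_var_subst (As i ^\<^sub>m 2) (As (i + 1))" using As i unfolding SaS_def by blast
  then show eq: "As i ^\<^sub>m 2 \<approx>\<^sub>g As (i + 1)" by (rule equiv_var_subst_imp_equivalent)
  have P: "As i \<in> carrier_mat n n" "elements_mat (As i) \<subseteq> range xvar" "recognizes_vertices (As i)"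
    using SaS_props[OF A As i] by blast+
  show "As i \<rightarrowtail> As (i + 1)"
    using coarser_trans[OF square_refines(1)[OF P]] eq unfolding equivalent_mats_def by blast
qed

text \<open>The stable graph recognizes vertices, so it bounds the first term; being closed under
  powers, it bounds each later square and its substitution.\<close>

lemma SaS_coarser_stable_graph:
  assumes A: "is_graph n A" and As: "SaS A As" and S: "stable_graph A S" and "i \<ge> 1"
  shows "As i \<rightarrowtail> S"
proof -
  note SP = stable_graph_props[OF A S]
  note SQ = square_coarser_of_Gam_coarser[OF SP(1,4)]
  show ?thesis
    using \<open>i \<ge> 1\<close>
  proof (induction i rule: dec_induct)
    case base
    then show ?case using diagonal_subst_coarser[OF A _ SP(1) SQ(2) SP(3)] As by (simp add: SaS_def)
  next
    case (step i)
    have "As i \<in> carrier_mat n n" using SaS_props[OF A As step(1)] by blast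
    then have "As i ^\<^sub>m 2 \<rightarrowtail> S" using pow_mat_coarser[OF SP(1,2) SQ _ step(3)] by blast
    moreover have "As (Suc i) \<rightarrowtail> As i ^\<^sub>m 2"
      using SaS_step(2)[OF A As step(1)] by (simp add: equivalent_mats_def)
    ultimately show ?case by (rule coarser_trans[rotated])
  qed
qed

theorem theorem3:
  fixes n :: nat and A :: "xpoly mat" and As :: "nat \<Rightarrow> xpoly mat"
  assumes "is_graph n A" and "SaS A As"
  shows "(\<forall>i \<ge> 1. recognizes_vertices (As i))
    \<and> (\<forall>i \<ge> 1. As i \<rightarrowtail> As (i + 1) \<and> gdim (As i) \<le> gdim (As (i + 1)))
    \<and> (\<forall>t \<ge> 1. gdim (As t) = gdim (As (t + 1)) \<longrightarrow> (\<forall>S. stable_graph A S \<longrightarrow> As t \<approx>\<^sub>g S))"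
proof (intro conjI allI impI)
  fix i :: nat assume i: "1 \<le> i"
  show "recognizes_vertices (As i)" using SaS_props[OF assms i] by blast
  show "As i \<rightarrowtail> As (i + 1)" by (rule SaS_step(1)[OF assms i])
  then show "gdim (As i) \<le> gdim (As (i + 1))" by (rule coarser_gdim_le)
next
  fix t S assume t: "1 \<le> t" and eq: "gdim (As t) = gdim (As (t + 1))" and S: "stable_graph A S"
  \<comment> \<open>Equal dimensions reverse the refinement step. The next term has the same
    equalities as the square, so the square of \<open>As t\<close> is coarser than
    \<open>As t\<close>, as the closure argument requires.\<close>
  have "As (t + 1) \<rightarrowtail> As t" by (rule coarser_gdim_eq[OF SaS_step(1)[OF assms t] eq])
  then have "As t ^\<^sub>m 2 \<rightarrowtail> As t"
    using SaS_step(2)[OF assms t] coarser_trans unfolding equivalent_mats_def by blast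
  then have "S \<rightarrowtail> As t"
    using stable_graph_coarser[OF assms(1) S] SaS_props[OF assms t] by blast
  then show "As t \<approx>\<^sub>g S"
    unfolding equivalent_mats_def using SaS_coarser_stable_graph[OF assms S t] by blast
qed

end
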